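(* For every even $n = 2k$ with $k \ge 1$, let $f_n : \{0,1\}^n \to \{0,1\}$ be the Boolean function \[ f_n(x) = Th^n_{k+1}(x) \vee \Big( Th^n_k(x) \wedge \bigwedge_{j=1}^{k} (\bar{x}_{2j-1} \vee \bar{x}_{2j}) \Big), \] where $Th^n_\ell(x) = 1$ if and only if $\sum_{i=1}^n x_i \ge \ell$. Then: a) $f_n$ is a monotone Boolean function; b) $f_n$ has a QTF representation of size $O(n)$ and tree-width $1$; c) $f_n$ has a positive QTF representation of size $O(n^2)$; d) every positive QTF representation of $f_n$ has size $\Omega(n^2)$, and so has tree-width $\Omega(n)$. Here the constants in $O(\cdot)$ and $\Omega(\cdot)$ are absolute, and the asymptotics are as $n \to \infty$ over even $n$.
   Context: A Boolean function $f:\{0,1\}^n\to\{0,1\}$ is monotone if $x \le y$ (coordinatewise) implies $f(x) \le f(y)$. The negation of a Boolean variable $x$ is written $\bar{x}$. A real multilinear polynomial is $p(x_1,\dots,x_n) = \sum_{I \in \mathcal{I}} \beta_I x_I$, where $\mathcal{I}$ is a family of subsets of $[n]=\{1,\dots,n\}$, the $\beta_I$ are nonzero reals, and $x_I = \prod_{i\in I} x_i$. Its degree is the maximal number of variables in a term, and its size is its number of terms. Let $\mathrm{sgn}(z) = 1$ if $z \ge 0$ and $\mathrm{sgn}(z)=0$ otherwise. A polynomial threshold function (PTF) representation of $f$ is a polynomial $p$ with $f(x) = \mathrm{sgn}(p(x))$ for all $x \in \{0,1\}^n$; it can equivalently be given as an inequality $p(x) \ge t$ with a real threshold $t$, where $f(x)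 = 1$ if and only if $p(x) \ge t$. A QTF (quadratic threshold function) representation is a PTF representation by a polynomial of degree at most 2. A PTF representation $p(x) \ge t$ is positive if every coefficient of $p$ is nonnegative, $p$ has no constant term, and $t$ is nonnegative. A positive QTF representation is a positive PTF representation of degree at most 2. The term-hypergraph of a real multilinear polynomial $p(x_1,\dots,x_n) = \sum_{I \in \mathcal{I}} \beta_I x_I$ (with $\mathcal{I}$ a family of subsets of $[n]$ and all $\beta_I$ nonzero) has vertex set $[n]$ and edge set $\mathcal{I}$. The primal graph of a hypergraph is the undirected graph obtained by replacing every hyperedge by a clique on its vertices. The tree-width of a polynomial (or of the PTF representation given by it) is the tree-width of the primal graph of its term-hypergraph. *)

theory Defs
  imports Complex_Main "HOL-Library.FuncSet" "HOL-Library.Poly_Mapping"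
begin

section \<open>Boolean functions\<close>

text \<open>
  The values 0 and 1 are rendered as \<^const>\<open>False\<close> and \<^const>\<open>True\<close>. Points are extensional
  functions, so the pointwise order on the function type restricts to the coordinatewise order
  on the cube.
\<close>

definition cube :: "nat \<Rightarrow> (nat \<Rightarrow> bool) set" where
  "cube n = {1..n} \<rightarrow>\<^sub>E UNIV"

definition monotone_boolean :: "nat \<Rightarrow> ((nat \<Rightarrow> bool) \<Rightarrow> bool) \<Rightarrow> bool" where
  "monotone_boolean n f \<longleftrightarrow> mono_on (cube n) f"

definition Th :: "nat \<Rightarrow> nat \<Rightarrow> (nat \<Rightarrow> bool) \<Rightarrow> bool" where
  "Th n l x \<longleftrightarrow> (\<Sum>i = 1..n. of_bool (x i)) \<ge> l"

text \<open>Parametrized by half the number of variables: \<open>pair_fun k\<close> is a function on \<open>cube (2 * k)\<close>.\<close>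

definition pair_fun :: "nat \<Rightarrow> (nat \<Rightarrow> bool) \<Rightarrow> bool" where
  "pair_fun k x \<longleftrightarrow>
     Th (2 * k) (k + 1) x \<or>
     (Th (2 * k) k x \<and> (\<forall>j\<in>{1..k}. \<not> x (2 * j - 1) \<or> \<not> x (2 * j)))"

section \<open>Multilinear polynomials and threshold representations\<close>

text \<open>
  A multilinear polynomial is the finitely supported map sending a set \<open>I\<close> of variable indices
  to the coefficient of the monomial \<open>\<Prod>i\<in>I. x i\<close>; its \<^const>\<open>Poly_Mapping.keys\<close> are the sets with nonzero
  coefficient, i.e. the terms.
\<close>

type_synonym mlpoly = "nat set \<Rightarrow>\<^sub>0 real"

definition ml_poly_on :: "nat \<Rightarrow> mlpoly \<Rightarrow> bool" where
  "ml_poly_on n p \<longleftrightarrow> Poly_Mapping.keys p \<subseteq> Pow {1..n}"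

definition ml_eval :: "mlpoly \<Rightarrow> (nat \<Rightarrow> bool) \<Rightarrow> real" where
  "ml_eval p x = (\<Sum>I\<in>Poly_Mapping.keys p. Poly_Mapping.lookup p I * (\<Prod>i\<in>I. of_bool (x i)))"

definition ml_degree :: "mlpoly \<Rightarrow> nat" where
  "ml_degree p = Max (insert 0 (card ` Poly_Mapping.keys p))"

definition ml_size :: "mlpoly \<Rightarrow> nat" where
  "ml_size p = card (Poly_Mapping.keys p)"

text \<open>The sign function has \<open>sgn z = 1\<close> iff \<open>z \<ge> 0\<close>, so it differs from \<^const>\<open>sgn\<close>.\<close>

definition threshold_sgn :: "real \<Rightarrow> bool" where
  "threshold_sgn z \<longleftrightarrow> z \<ge> 0"

definition ptf_rep :: "nat \<Rightarrow> ((nat \<Rightarrow> bool) \<Rightarrow> bool) \<Rightarrow> mlpoly \<Rightarrow> bool" where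
  "ptf_rep n f p \<longleftrightarrow>
     ml_poly_on n p \<and> (\<forall>x\<in>cube n. f x = threshold_sgn (ml_eval p x))"

definition qtf_rep :: "nat \<Rightarrow> ((nat \<Rightarrow> bool) \<Rightarrow> bool) \<Rightarrow> mlpoly \<Rightarrow> bool" where
  "qtf_rep n f p \<longleftrightarrow> ptf_rep n f p \<and> ml_degree p \<le> 2"

text \<open>The same notion in the form of an inequality \<open>p(x) \<ge> t\<close>.\<close>

definition ptf_rep_ge :: "nat \<Rightarrow> ((nat \<Rightarrow> bool) \<Rightarrow> bool) \<Rightarrow> mlpoly \<Rightarrow> real \<Rightarrow> bool" where
  "ptf_rep_ge n f p t \<longleftrightarrow>
     ml_poly_on n p \<and> (\<forall>x\<in>cube n. f x \<longleftrightarrow> ml_eval p x \<ge> t)"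

definition positive_ptf_rep :: "nat \<Rightarrow> ((nat \<Rightarrow> bool) \<Rightarrow> bool) \<Rightarrow> mlpoly \<Rightarrow> real \<Rightarrow> bool" where
  "positive_ptf_rep n f p t \<longleftrightarrow>
     ptf_rep_ge n f p t \<and> (\<forall>I. Poly_Mapping.lookup p I \<ge> 0) \<and> {} \<notin> Poly_Mapping.keys p \<and> t \<ge> 0"

definition positive_qtf_rep :: "nat \<Rightarrow> ((nat \<Rightarrow> bool) \<Rightarrow> bool) \<Rightarrow> mlpoly \<Rightarrow> real \<Rightarrow> bool" where
  "positive_qtf_rep n f p t \<longleftrightarrow> positive_ptf_rep n f p t \<and> ml_degree p \<le> 2"

section \<open>Tree-width\<close>

text \<open>Undirected simple graphs are given by a vertex set and a set of two-element edges.\<close>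

definition simple_graph :: "'a set \<Rightarrow> 'a set set \<Rightarrow> bool" where
  "simple_graph V E \<longleftrightarrow> finite V \<and> (\<forall>e\<in>E. e \<subseteq> V \<and> card e = 2)"

text \<open>Connectedness of the subgraph induced by \<open>W\<close>; the empty set counts as connected.\<close>

definition induced_connected :: "'a set set \<Rightarrow> 'a set \<Rightarrow> bool" where
  "induced_connected E W \<longleftrightarrow>
     (\<forall>u\<in>W. \<forall>v\<in>W. (u, v) \<in> {(a, b). a \<in> W \<and> b \<in> W \<and> {a, b} \<in> E}\<^sup>*)"

definition is_cycle :: "'a set set \<Rightarrow> 'a list \<Rightarrow> bool" where
  "is_cycle E c \<longleftrightarrow>
     length c \<ge> 3 \<and> distinct c \<and>
     (\<forall>i<length c. {c ! i, c ! (Suc i mod length c)} \<in> E)"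

definition is_tree :: "'a set \<Rightarrow> 'a set set \<Rightarrow> bool" where
  "is_tree V E \<longleftrightarrow>
     simple_graph V E \<and> V \<noteq> {} \<and> induced_connected E V \<and> (\<nexists>c. is_cycle E c)"

definition tree_decomposition ::
  "'a set \<Rightarrow> 'a set set \<Rightarrow> 'b set \<Rightarrow> 'b set set \<Rightarrow> ('b \<Rightarrow> 'a set) \<Rightarrow> bool" where
  "tree_decomposition V E T F B \<longleftrightarrow>
     is_tree T F \<and>
     (\<Union>s\<in>T. B s) = V \<and>
     (\<forall>e\<in>E. \<exists>s\<in>T. e \<subseteq> B s) \<and>
     (\<forall>v\<in>V. induced_connected F {s \<in> T. v \<in> B s})"

text \<open>For a nonempty vertex set some bag is nonempty, so the truncated subtraction is harmless.\<close>

definition decomposition_width :: "'b set \<Rightarrow> ('b \<Rightarrow> 'a set) \<Rightarrow> nat" where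
  "decomposition_width T B = Max ((\<lambda>s. card (B s)) ` T) - 1"

text \<open>
  Since the trees are finite, it is no restriction to take natural numbers as their nodes.
\<close>

definition tree_width :: "'a set \<Rightarrow> 'a set set \<Rightarrow> nat" where
  "tree_width V E =
     (LEAST w. \<exists>(T :: nat set) F B. tree_decomposition V E T F B \<and> decomposition_width T B = w)"

definition primal_edges :: "'a set set \<Rightarrow> 'a set set" where
  "primal_edges H = {{u, v} | u v I. I \<in> H \<and> u \<in> I \<and> v \<in> I \<and> u \<noteq> v}"

text \<open>The term-hypergraph of \<open>p\<close> on \<open>n\<close> variables has vertices \<open>{1..n}\<close> and hyperedges \<open>Poly_Mapping.keys p\<close>.\<close>

definition ml_tree_width :: "nat \<Rightarrow> mlpoly \<Rightarrow> nat" where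
  "ml_tree_width n p = tree_width {1..n} (primal_edges (Poly_Mapping.keys p))"

end

theory Submission imports Defs begin

text \<open>
  A multilinear polynomial evaluated at the indicator vector of \<open>X\<close> is the sum of the coefficients
  of all \<open>I \<subseteq> X\<close>. With \<open>s = card X\<close> and \<open>m\<close> the number of pairs \<open>{2j - 1, 2j}\<close> inside \<open>X\<close>,
  the function \<open>f\<^sub>n\<close> is true iff \<open>s > k\<close>, or \<open>s = k\<close> and \<open>m = 0\<close>. It is represented by
  \<open>k s - m \<ge> k\<^sup>2\<close>, whose graph is a perfect matching, and by \<open>s + (s choose 2) - m \<ge> k + (k choose 2)\<close>,
  which is positive.

  For the lower bound take two pairs \<open>{a, a'}\<close>, \<open>{b, b'}\<close> and one element from each other pair. Then
  \<open>{a, b}\<close> and \<open>{a', b'}\<close> complete this to true points, \<open>{a, a'}\<close> and \<open>{b, b'}\<close> to false points.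
  The linear contributions cancel, so the coefficients satisfy
  \<open>\<beta> a b + \<beta> a' b' > \<beta> a a' + \<beta> b b' \<ge> 0\<close>, and some term joins the two pairs. This gives
  \<open>k choose 2\<close> edges, whereas a graph of tree-width \<open>w\<close> has at most \<open>w\<close> times as many edges as vertices.
\<close>

section \<open>Polynomials as set functions\<close>

definition true_set :: "nat \<Rightarrow> (nat \<Rightarrow> bool) \<Rightarrow> nat set" where
  "true_set n x = {i \<in> {1..n}. x i}"

lemma true_set_subset: "true_set n x \<subseteq> {1..n}"
  by (auto simp: true_set_def)

lemma finite_true_set [simp]: "finite (true_set n x)"
  by (simp add: true_set_def)

text \<open>Lets values at points of the cube be used for arbitrary subsets of
  \<open>{1..n}\<close>; restricting the indicator makes it extensional, as the cube
  demands.\<close>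

lemma obtain_point:
  assumes "X \<subseteq> {1..n}"
  obtains x where "x \<in> cube n" "true_set n x = X"
proof
  show "(\<lambda>i\<in>{1..n}. i \<in> X) \<in> cube n" by (auto simp: cube_def)
  show "true_set n (\<lambda>i\<in>{1..n}. i \<in> X) = X" using assms by (auto simp: true_set_def)
qed

text \<open>A monomial takes the value 1 if its index set lies in the true set and 0 otherwise. Sets
  outside the support have coefficient 0, so the sum can run over a whole power set that does not
  depend on \<open>p\<close>.\<close>

lemma ml_eval_eq:
  assumes "ml_poly_on n p"
  shows "ml_eval p x = (\<Sum>I\<in>Pow (true_set n x). Poly_Mapping.lookup p I)"
proof -
  have sub: "I \<subseteq> {1..n}" if "I \<in> Poly_Mapping.keys p" for I
    using assms that by (auto simp: ml_poly_on_def)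
  have *: "Poly_Mapping.lookup p I * (\<Prod>i\<in>I. of_bool (x i))
      = (if I \<subseteq> true_set n x then Poly_Mapping.lookup p I else 0)" if I: "I \<in> Poly_Mapping.keys p" for I
  proof (cases "I \<subseteq> true_set n x")
    case True
    then have "(\<Prod>i\<in>I. of_bool (x i)) = (1::real)"
      by (intro prod.neutral) (auto simp: true_set_def)
    with True show ?thesis by simp
  next
    case False
    then obtain i where "i \<in> I" "\<not> x i" using sub[OF I] by (auto simp: true_set_def)
    moreover have "finite I" using sub[OF I] finite_subset by blast
    ultimately have "(\<Prod>i\<in>I. of_bool (x i)) = (0::real)" by (auto intro: prod_zero)
    with False show ?thesis by simp
  qed
  have "ml_eval p x = (\<Sum>I\<in>Poly_Mapping.keys p. if I \<subseteq> true_set n x then Poly_Mapping.lookup p I else 0)"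
    unfolding ml_eval_def by (intro sum.cong refl *)
  also have "\<dots> = (\<Sum>I\<in>Poly_Mapping.keys p \<inter> Pow (true_set n x). Poly_Mapping.lookup p I)"
    by (simp add: sum.inter_restrict Pow_def)
  also have "\<dots> = (\<Sum>I\<in>Pow (true_set n x). Poly_Mapping.lookup p I)"
    by (intro sum.mono_neutral_left) (auto simp: in_keys_iff)
  finally show ?thesis .
qed

lemma Th_iff: "Th n l x \<longleftrightarrow> l \<le> card (true_set n x)"
  by (simp add: Th_def true_set_def Int_def)

section \<open>The matching of consecutive indices and its role in the function\<close>

definition pairs :: "nat \<Rightarrow> nat set set" where
  "pairs k = (\<lambda>j. {2 * j - 1, 2 * j}) ` {1..k}"

lemma finite_pairs [simp]: "finite (pairs k)"
  by (simp add: pairs_def)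

lemma card_pairs_le: "card (pairs k) \<le> k"
  unfolding pairs_def using card_image_le[of "{1..k}"] by fastforce

lemma pairs_subset: "e \<in> pairs k \<Longrightarrow> e \<subseteq> {1..2 * k}"
  by (auto simp: pairs_def)

lemma pairs_card: "e \<in> pairs k \<Longrightarrow> card e = 2"
  by (auto simp: pairs_def card_insert_if)

lemma pairs_disjoint:
  assumes "e \<in> pairs k" "e' \<in> pairs k" "e \<noteq> e'"
  shows "e \<inter> e' = {}"
proof -
  obtain i where "1 \<le> i" "e = {2 * i - 1, 2 * i}" using assms(1) by (auto simp: pairs_def)
  moreover obtain j where "1 \<le> j" "e' = {2 * j - 1, 2 * j}" using assms(2) by (auto simp: pairs_def)
  \<comment> \<open>Positivity of the indices keeps the truncated subtraction exact, so that parity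
    separates \<open>2 * i - 1\<close> from \<open>2 * j\<close>.\<close>
  ultimately have "1 \<le> i" "1 \<le> j" "i \<noteq> j" "e = {2 * i - 1, 2 * i}" "e' = {2 * j - 1, 2 * j}"
    using assms(3) by auto
  then show ?thesis by (simp; presburger)
qed

lemma pair_fun_iff:
  "pair_fun k x \<longleftrightarrow> k < card (true_set (2 * k) x) \<or>
     (card (true_set (2 * k) x) = k \<and> pairs k \<inter> Pow (true_set (2 * k) x) = {})"
proof -
  have "(\<forall>j\<in>{1..k}. \<not> x (2 * j - 1) \<or> \<not> x (2 * j)) \<longleftrightarrow>
      (\<forall>j\<in>{1..k}. \<not> {2 * j - 1, 2 * j} \<subseteq> true_set (2 * k) x)"
    by (intro ball_cong) (auto simp: true_set_def)
  also have "\<dots> \<longleftrightarrow> pairs k \<inter> Pow (true_set (2 * k) x) = {}"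
    unfolding pairs_def by blast
  finally have "(\<forall>j\<in>{1..k}. \<not> x (2 * j - 1) \<or> \<not> x (2 * j)) \<longleftrightarrow>
      pairs k \<inter> Pow (true_set (2 * k) x) = {}" .
  then show ?thesis by (auto simp: pair_fun_def Th_iff)
qed

text \<open>A true point has at least \<open>k\<close> ones, so any strictly larger point has more
  than \<open>k\<close> and is true whatever pairs it contains.\<close>

lemma monotone_pair_fun: "monotone_boolean (2 * k) (pair_fun k)"
  unfolding monotone_boolean_def
proof (rule mono_onI)
  fix x y :: "nat \<Rightarrow> bool"
  assume "x \<le> y"
  then have sub: "true_set (2 * k) x \<subseteq> true_set (2 * k) y"
    by (auto simp: true_set_def le_fun_def)
  show "pair_fun k x \<le> pair_fun k y"
  proof (cases "true_set (2 * k) x = true_set (2 * k) y")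
    case True
    then show ?thesis by (simp add: pair_fun_iff)
  next
    case False
    then have "card (true_set (2 * k) x) < card (true_set (2 * k) y)"
      using sub by (intro psubset_card_mono) auto
    then show ?thesis by (auto simp: pair_fun_iff)
  qed
qed

section \<open>Quadratic polynomials with uniform coefficients\<close>

text \<open>One family for both constructions: the sparse one uses the pairs as \<open>Q\<close>
  with coefficient -1, the positive one all other two-element sets with coefficient 1. For such
  \<open>Q\<close> the three indicators have disjoint supports.\<close>

definition quad_poly :: "nat \<Rightarrow> real \<Rightarrow> real \<Rightarrow> real \<Rightarrow> nat set set \<Rightarrow> mlpoly" where
  "quad_poly n a b c Q = Abs_poly_mapping (\<lambda>I.
     a * of_bool (I = {}) + b * of_bool (I \<in> (\<lambda>i. {i}) ` {1..n}) + c * of_bool (I \<in> Q))"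

context
  fixes n :: nat and Q :: "nat set set"
  assumes Q: "\<And>I. I \<in> Q \<Longrightarrow> I \<subseteq> {1..n} \<and> card I = 2"
begin

lemma finite_two_sets: "finite Q"
  by (rule finite_subset[of _ "Pow {1..n}"]) (use Q in auto)

lemma lookup_quad_poly:
  "Poly_Mapping.lookup (quad_poly n a b c Q) = (\<lambda>I.
     a * of_bool (I = {}) + b * of_bool (I \<in> (\<lambda>i. {i}) ` {1..n}) + c * of_bool (I \<in> Q))"
  unfolding quad_poly_def
proof (rule lookup_Abs_poly_mapping)
  show "finite {I. a * of_bool (I = {}) + b * of_bool (I \<in> (\<lambda>i. {i}) ` {1..n}) + c * of_bool (I \<in> Q) \<noteq> 0}"
    by (rule finite_subset[of _ "{{}} \<union> (\<lambda>i. {i}) ` {1..n} \<union> Q"]) (use finite_two_sets in auto)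
qed

lemma keys_quad_poly:
  "Poly_Mapping.keys (quad_poly n a b c Q) \<subseteq> {{}} \<union> (\<lambda>i. {i}) ` {1..n} \<union> Q"
  by (auto simp: in_keys_iff lookup_quad_poly)

lemma ml_poly_on_quad_poly: "ml_poly_on n (quad_poly n a b c Q)"
  unfolding ml_poly_on_def using keys_quad_poly Q by fastforce

lemma ml_degree_quad_poly: "ml_degree (quad_poly n a b c Q) \<le> 2"
  unfolding ml_degree_def
  by (subst Max_le_iff) (use keys_quad_poly Q in \<open>fastforce+\<close>)

lemma ml_size_quad_poly: "ml_size (quad_poly n a b c Q) \<le> 1 + n + card Q"
proof -
  have "ml_size (quad_poly n a b c Q) \<le> card ({{}} \<union> (\<lambda>i. {i}) ` {1..n} \<union> Q)"
    unfolding ml_size_def by (intro card_mono keys_quad_poly) (use finite_two_sets in auto)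
  also have "\<dots> \<le> card {{}::nat set} + card ((\<lambda>i::nat. {i}) ` {1..n}) + card Q"
    by (intro order.trans[OF card_Un_le] add_mono card_Un_le order.refl)
  also have "\<dots> = 1 + n + card Q"
    by (simp add: card_image)
  finally show ?thesis .
qed

lemma ml_eval_quad_poly:
  "ml_eval (quad_poly n a b c Q) x =
     a + b * card (true_set n x) + c * card (Q \<inter> Pow (true_set n x))"
proof -
  let ?X = "true_set n x"
  have fin: "finite (Pow ?X)" by simp
  have 1: "(\<Sum>I\<in>Pow ?X. of_bool (I = {})) = (1::real)"
    using fin by (simp add: of_bool_def)
  have "Pow ?X \<inter> {I. I \<in> (\<lambda>i. {i}) ` {1..n}} = (\<lambda>i. {i}) ` ?X"
    using true_set_subset[of n x] by auto
  then have 2: "(\<Sum>I\<in>Pow ?X. of_bool (I \<in> (\<lambda>i. {i}) ` {1..n})) = real (card ?X)"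
    using fin by (simp add: card_image)
  have 3: "(\<Sum>I\<in>Pow ?X. of_bool (I \<in> Q)) = real (card (Q \<inter> Pow ?X))"
    using fin by (simp add: Int_commute)
  show ?thesis
    unfolding ml_eval_eq[OF ml_poly_on_quad_poly] lookup_quad_poly
    by (simp only: sum.distrib flip: sum_distrib_left) (simp only: 1 2 3 mult_1_right)
qed

text \<open>The constant and linear terms yield no edges, a two-element term is its own clique, and
  \<open>c\<close> is the coefficient of every set in \<open>Q\<close>.\<close>

lemma primal_edges_quad_poly:
  assumes "c \<noteq> 0"
  shows "primal_edges (Poly_Mapping.keys (quad_poly n a b c Q)) = Q"
proof (intro equalityI subsetI)
  fix e assume "e \<in> primal_edges (Poly_Mapping.keys (quad_poly n a b c Q))"
  then obtain u v I where e: "e = {u, v}" "u \<in> I" "v \<in> I" "u \<noteq> v"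
    and "I \<in> Poly_Mapping.keys (quad_poly n a b c Q)"
    by (auto simp: primal_edges_def)
  then have I: "I \<in> Q" using keys_quad_poly by fastforce
  then have "card I = 2" "finite I" using Q finite_subset by (blast, blast)
  then have "{u, v} = I" using e by (intro card_subset_eq) auto
  then show "e \<in> Q" using I e by simp
next
  fix e assume e: "e \<in> Q"
  then obtain u v where uv: "e = {u, v}" "u \<noteq> v" using Q by (meson card_2_iff)
  have "e \<in> Poly_Mapping.keys (quad_poly n a b c Q)"
    using assms e uv by (auto simp: in_keys_iff lookup_quad_poly)
  then show "e \<in> primal_edges (Poly_Mapping.keys (quad_poly n a b c Q))"
    unfolding primal_edges_def using uv by blast
qed

end

section \<open>Tree decompositions\<close>

text \<open>Every edge contains the centre 1, whereas a cycle of length at least 3 passes through 1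
  at most once and so has an edge avoiding it.\<close>

lemma is_tree_star:
  assumes "1 \<le> k"
  shows "is_tree {1..k::nat} ((\<lambda>j. {1, j}) ` {2..k})"
proof -
  let ?F = "(\<lambda>j. {1, j}) ` {2..k}"
  let ?R = "{(a, b). a \<in> {1..k} \<and> b \<in> {1..k} \<and> {a, b} \<in> ?F}"
  have "(u, 1) \<in> ?R\<^sup>* \<and> (1, u) \<in> ?R\<^sup>*" if "u \<in> {1..k}" for u
  proof (cases "u = 1")
    case False
    then have "(u, 1) \<in> ?R" "(1, u) \<in> ?R" using that assms by (auto simp: insert_commute)
    then show ?thesis by blast
  qed auto
  then have "induced_connected ?F {1..k}"
    unfolding induced_connected_def by (meson rtrancl_trans)
  moreover have "\<not> is_cycle ?F c" for c
  proof
    assume c: "is_cycle ?F c"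
    then have len: "3 \<le> length c" and dist: "distinct c" and "c \<noteq> []" by (auto simp: is_cycle_def)
    have one: "c ! i = 1 \<or> c ! (Suc i mod length c) = 1" if "i < length c" for i
    proof -
      have "{c ! i, c ! (Suc i mod length c)} \<in> ?F" using c that by (auto simp: is_cycle_def)
      then have "1 \<in> {c ! i, c ! (Suc i mod length c)}" by blast
      then show ?thesis by auto
    qed
    have eq: "i = j" if "c ! i = 1" "c ! j = 1" "i < length c" "j < length c" for i j
      using that dist by (metis nth_eq_iff_index_eq)
    have "c ! 0 = 1 \<or> c ! 1 = 1" "c ! 1 = 1 \<or> c ! 2 = 1"
      using one[of 0] one[of 1] len \<open>c \<noteq> []\<close> by (auto simp: numeral_2_eq_2)
    then have "c ! 1 = 1" using eq[of 0 2] len \<open>c \<noteq> []\<close> by fastforce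
    moreover have "c ! 2 = 1 \<or> c ! (3 mod length c) = 1"
      using one[of 2] len by (auto simp: numeral_3_eq_3 numeral_2_eq_2)
    \<comment> \<open>The third edge ends at position 0 if the cycle is a triangle and at position 3
      otherwise; in neither case does it return to position 1.\<close>
    moreover have "3 mod length c \<noteq> 1" "3 mod length c < length c"
      using len by (cases "length c = 3"; auto)+
    ultimately show False using eq[of 1 2] eq[of 1 "3 mod length c"] len by linarith
  qed
  ultimately show ?thesis
    using assms by (auto simp: is_tree_def simple_graph_def card_insert_if)
qed

lemma tree_width_le:
  assumes "tree_decomposition V E (T :: nat set) F B" "decomposition_width T B \<le> w"
  shows "tree_width V E \<le> w"
proof -
  have "tree_width V E \<le> decomposition_width T B"
    unfolding tree_width_def by (rule Least_le) (use assms in blast)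
  then show ?thesis using assms by simp
qed

text \<open>The one-node tree with bag \<open>V\<close> shows that some width is attained, hence the
  least one is too.\<close>

lemma tree_width_decomposition:
  assumes "\<And>e. e \<in> E \<Longrightarrow> e \<subseteq> V"
  obtains T :: "nat set" and F B
  where "tree_decomposition V E T F B" "decomposition_width T B = tree_width V E"
proof -
  define P where "P w \<longleftrightarrow> (\<exists>(T :: nat set) F B. tree_decomposition V E T F B \<and> decomposition_width T B = w)" for w
  have "is_tree {1::nat} {}" using is_tree_star[of 1] by simp
  then have "tree_decomposition V E {1::nat} {} (\<lambda>_. V)"
    using assms by (auto simp: tree_decomposition_def induced_connected_def)
  then have "P (decomposition_width {1::nat} (\<lambda>_. V))" unfolding P_def by blast
  then have "P (LEAST w. P w)" by (rule LeastI)
  then have "P (tree_width V E)" by (simp add: tree_width_def P_def)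
  then show ?thesis using that unfolding P_def by blast
qed

lemma card_bag_le:
  assumes "tree_decomposition V E T F B" "s \<in> T"
  shows "card (B s) \<le> Suc (decomposition_width T B)"
proof -
  have "finite T" using assms by (auto simp: tree_decomposition_def is_tree_def simple_graph_def)
  then have "card (B s) \<le> Max ((\<lambda>s. card (B s)) ` T)" using assms(2) by (intro Max_ge) auto
  then show ?thesis by (simp add: decomposition_width_def)
qed

text \<open>Taking each pair as a bag, every vertex lies in exactly one bag, so any tree on the bags
  will do; a star is used. Conversely, the bag covering \<open>{1, 2}\<close> has at least two
  elements.\<close>

lemma tree_width_pairs:
  assumes "1 \<le> k"
  shows "tree_width {1..2 * k} (pairs k) = 1"
proof (rule antisym)
  let ?F = "(\<lambda>j. {1, j}) ` {2..k}" and ?B = "\<lambda>j::nat. {2 * j - 1, 2 * j}"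
  have "(\<Union>s\<in>{1..k}. ?B s) = {1..2 * k}"
  proof (intro equalityI subsetI)
    fix v assume v: "v \<in> {1..2 * k}"
    have "(v + 1) div 2 \<in> {1..k}" using v by auto
    moreover have "v \<in> ?B ((v + 1) div 2)" using v by (simp; presburger)
    ultimately show "v \<in> (\<Union>s\<in>{1..k}. ?B s)" by blast
  qed auto
  moreover have "induced_connected ?F {s \<in> {1..k}. v \<in> ?B s}" for v
  proof -
    have "s = t" if "s \<in> {1..k}" "v \<in> ?B s" "t \<in> {1..k}" "v \<in> ?B t" for s t
    proof -
      have "2 \<le> 2 * s" "2 \<le> 2 * t" "v = 2 * s - 1 \<or> v = 2 * s" "v = 2 * t - 1 \<or> v = 2 * t"
        using that by auto
      then show ?thesis by presburger
    qed
    then have "s = t" if "s \<in> {s \<in> {1..k}. v \<in> ?B s}" "t \<in> {s \<in> {1..k}. v \<in> ?B s}" for s t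
      using that by blast
    then show ?thesis unfolding induced_connected_def by blast
  qed
  ultimately have "tree_decomposition {1..2 * k} (pairs k) {1..k} ?F ?B"
    unfolding tree_decomposition_def using is_tree_star[OF assms] by (auto simp: pairs_def)
  moreover have "decomposition_width {1..k} ?B \<le> 1"
  proof -
    have "Max ((\<lambda>s. card (?B s)) ` {1..k}) \<le> 2"
      using assms by (intro Max.boundedI) (auto simp: card_insert_if)
    then show ?thesis by (simp add: decomposition_width_def)
  qed
  ultimately show "tree_width {1..2 * k} (pairs k) \<le> 1" by (rule tree_width_le)
next
  obtain T :: "nat set" and F B where TD: "tree_decomposition {1..2 * k} (pairs k) T F B"
    and w: "decomposition_width T B = tree_width {1..2 * k} (pairs k)"
    using tree_width_decomposition[of "pairs k" "{1..2 * k}"] pairs_subset by blast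
  have e: "{1, 2} \<in> pairs k" using assms by (force simp: pairs_def)
  then obtain s where s: "s \<in> T" "{1, 2} \<subseteq> B s"
    using TD unfolding tree_decomposition_def by blast
  have "B s \<subseteq> {1..2 * k}" using TD s unfolding tree_decomposition_def by blast
  then have "card {1, 2 :: nat} \<le> card (B s)" using s by (intro card_mono) (auto intro: finite_subset)
  then show "1 \<le> tree_width {1..2 * k} (pairs k)"
    using card_bag_le[OF TD s(1)] w by simp
qed

section \<open>Sparsity of graphs of bounded tree-width\<close>

text \<open>A longest path in \<open>W\<close> starts in such a vertex: two neighbours on the path would close a cycle.\<close>

lemma acyclic_ex_leaf:
  assumes "finite W" "W \<noteq> {}" and acyclic: "\<nexists>c. is_cycle F c"
    and irrefl: "\<And>v. {v} \<notin> F"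
  shows "\<exists>l\<in>W. \<exists>s. \<forall>y\<in>W. {l, y} \<in> F \<longrightarrow> y = s"
proof -
  define path where "path xs \<longleftrightarrow> xs \<noteq> [] \<and> distinct xs \<and> set xs \<subseteq> W \<and>
    (\<forall>i. Suc i < length xs \<longrightarrow> {xs ! i, xs ! Suc i} \<in> F)" for xs
  obtain w where "w \<in> W" using assms by blast
  then have "path [w]" by (simp add: path_def)
  moreover have "length xs < Suc (card W)" if "path xs" for xs
    using that assms(1) by (metis card_mono distinct_card less_Suc_eq_le path_def)
  ultimately obtain xs where xs: "path xs" and longest: "\<And>ys. path ys \<Longrightarrow> length ys \<le> length xs"
    using ex_has_greatest_nat[of path "[w]" length "Suc (card W)"] by (metis less_imp_le)
  define l where "l = xs ! 0"
  have "l \<in> W" using xs by (auto simp: path_def l_def)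
  \<comment> \<open>A neighbour off the path could be put in front of it, against maximality;
    position 0 is excluded because \<open>F\<close> has no loops.\<close>
  have nbr: "\<exists>i. 1 \<le> i \<and> i < length xs \<and> xs ! i = y" if "y \<in> W" "{l, y} \<in> F" for y
  proof -
    have "y \<in> set xs"
    proof (rule ccontr)
      assume "y \<notin> set xs"
      moreover have "{(y # xs) ! i, (y # xs) ! Suc i} \<in> F" if "Suc i < length (y # xs)" for i
        using that xs \<open>{l, y} \<in> F\<close> by (cases i) (auto simp: path_def l_def insert_commute)
      ultimately have "path (y # xs)"
        using xs that(1) unfolding path_def by simp
      then show False using longest by fastforce
    qed
    then obtain i where "i < length xs" "xs ! i = y" by (auto simp: in_set_conv_nth)
    moreover from this have "i \<noteq> 0" using that(2) irrefl[of l] by (cases i) (auto simp: l_def)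
    ultimately show ?thesis by (intro exI[of _ i]) auto
  qed
  \<comment> \<open>The path up to position \<open>j\<close> closes to a cycle through
    \<open>l\<close>; \<open>1 \<le> i < j\<close> gives it at least three vertices.\<close>
  have close: False if "1 \<le> i" "i < j" "j < length xs" "{l, xs ! j} \<in> F" for i j
  proof -
    have len: "length (take (Suc j) xs) = Suc j" using that by simp
    have "{take (Suc j) xs ! i', take (Suc j) xs ! (Suc i' mod Suc j)} \<in> F" if "i' < Suc j" for i'
    proof (cases "i' = j")
      case True
      then show ?thesis using \<open>{l, xs ! j} \<in> F\<close> by (simp add: l_def insert_commute)
    next
      case False
      then show ?thesis using that \<open>j < length xs\<close> xs by (auto simp: path_def)
    qed
    then have "is_cycle F (take (Suc j) xs)"
      unfolding is_cycle_def len using that xs by (auto simp: path_def)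
    then show False using acyclic by blast
  qed
  have "y = z" if "y \<in> W" "{l, y} \<in> F" "z \<in> W" "{l, z} \<in> F" for y z
    using nbr[OF that(1,2)] nbr[OF that(3,4)] close that by (metis linorder_neqE_nat)
  then show ?thesis using \<open>l \<in> W\<close> by blast
qed

text \<open>A walk can enter and leave \<open>l\<close> only through \<open>s\<close>, so each visit
  to \<open>l\<close> can be cut out.\<close>

lemma induced_connected_remove_leaf:
  assumes conn: "induced_connected F W" and leaf: "\<And>y. y \<in> W \<Longrightarrow> {l, y} \<in> F \<Longrightarrow> y = s"
    and "{l} \<notin> F"
  shows "induced_connected F (W - {l})"
  unfolding induced_connected_def
proof (intro ballI)
  fix u v assume u: "u \<in> W - {l}" and v: "v \<in> W - {l}"
  define R where "R W = {(a, b). a \<in> W \<and> b \<in> W \<and> {a, b} \<in> F}" for W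
  have "(u, v) \<in> (R W)\<^sup>*" using conn u v by (auto simp: induced_connected_def R_def)
  \<comment> \<open>Invariant along the walk: while it sits at \<open>l\<close>, the shortened walk
    waits at \<open>s\<close>.\<close>
  then have "(v \<noteq> l \<longrightarrow> (u, v) \<in> (R (W - {l}))\<^sup>*) \<and> (v = l \<longrightarrow> (u, s) \<in> (R (W - {l}))\<^sup>*)"
  proof (induction rule: rtrancl_induct)
    case base
    then show ?case using u by auto
  next
    case (step y z)
    then have yz: "y \<in> W" "z \<in> W" "{y, z} \<in> F" by (auto simp: R_def)
    consider "y = l" | "z = l" | "y \<noteq> l" "z \<noteq> l" by blast
    then show ?case
    proof cases
      case 1
      then have "z = s" "z \<noteq> l" using leaf[of z] yz assms(3) by auto
      then show ?thesis using step.IH 1 by auto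
    next
      case 2
      then have "y = s" "y \<noteq> l" using leaf[of y] yz assms(3) by (auto simp: insert_commute)
      then show ?thesis using step.IH 2 by auto
    next
      case 3
      then have "(y, z) \<in> R (W - {l})" using yz by (auto simp: R_def)
      then show ?thesis using step.IH 3 by (auto intro: rtrancl_into_rtrancl)
    qed
  qed
  then show "(u, v) \<in> {(a, b). a \<in> W - {l} \<and> b \<in> W - {l} \<and> {a, b} \<in> F}\<^sup>*"
    using v by (auto simp: R_def)
qed

text \<open>
  Induction on the host forest: a vertex occurring only in the bag of a leaf has degree at most \<open>w\<close>.
  After deleting all these vertices the leaf bag is contained in the bag of its neighbour.
\<close>

lemma card_edges_forest_decomposition:
  assumes "finite T" "finite V"
    and "\<nexists>c. is_cycle F c" "\<And>v. {v} \<notin> F"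
    and "\<And>e. e \<in> E \<Longrightarrow> e \<subseteq> V \<and> card e = 2"
    and "\<And>e. e \<in> E \<Longrightarrow> \<exists>s\<in>T. e \<subseteq> B s"
    and "\<And>v. v \<in> V \<Longrightarrow> induced_connected F {s \<in> T. v \<in> B s}"
    and "\<And>s. s \<in> T \<Longrightarrow> finite (B s) \<and> card (B s) \<le> Suc w"
  shows "card E \<le> w * card V"
  using assms
proof (induction "card T" arbitrary: T V E)
  case 0
  then have "E = {}" by fastforce
  then show ?case by simp
next
  case (Suc m)
  then have "T \<noteq> {}" by auto
  then obtain l s where l: "l \<in> T" and leaf: "\<And>y. y \<in> T \<Longrightarrow> {l, y} \<in> F \<Longrightarrow> y = s"
    using acyclic_ex_leaf[of T F] Suc.prems by metis
  define P where "P = {v \<in> V \<inter> B l. \<forall>t\<in>T - {l}. v \<notin> B t}"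
  have finP: "finite P" using Suc.prems(2) by (auto simp: P_def)
  \<comment> \<open>The nodes whose bags contain \<open>v\<close> are connected and include
    \<open>l\<close> and another node, so a walk between them leaves \<open>l\<close> through its
    only neighbour \<open>s\<close>.\<close>
  have nbr: "s \<in> T - {l} \<and> v \<in> B s" if v: "v \<in> V" "v \<in> B l" "v \<notin> P" for v
  proof -
    obtain t where t: "t \<in> T" "t \<noteq> l" "v \<in> B t" using v by (auto simp: P_def)
    have "(l, t) \<in> {(a, b). a \<in> {s \<in> T. v \<in> B s} \<and> b \<in> {s \<in> T. v \<in> B s} \<and> {a, b} \<in> F}\<^sup>*"
      using Suc.prems(7)[OF v(1)] l t v unfolding induced_connected_def by blast
    then obtain y where "y \<in> T" "v \<in> B y" "{l, y} \<in> F"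
      using t(2) by (cases rule: converse_rtranclE) auto
    moreover from this have "y \<noteq> l" using Suc.prems(4) by auto
    ultimately show ?thesis using leaf by blast
  qed
  define E1 where "E1 = {e \<in> E. e \<inter> P \<noteq> {}}"
  have finE: "finite E" by (rule finite_subset[of _ "Pow V"]) (use Suc.prems in auto)
  have "card (E - E1) \<le> w * card (V - P)"
  proof (rule Suc.hyps(1)[of "T - {l}"])
    show "m = card (T - {l})" using Suc.hyps(2) Suc.prems(1) l by simp
    show "e \<subseteq> V - P \<and> card e = 2" if "e \<in> E - E1" for e
      using that Suc.prems(5)[of e] by (auto simp: E1_def)
    show "\<exists>s\<in>T - {l}. e \<subseteq> B s" if e: "e \<in> E - E1" for e
    proof (cases "e \<subseteq> B l")
      case True
      \<comment> \<open>The endpoints lie in the leaf bag but outside \<open>P\<close>, so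
        \<open>nbr\<close> puts them all in the bag of \<open>s\<close>; nonemptiness of
        \<open>e\<close> ensures that \<open>nbr\<close> applies at all.\<close>
      have "e \<subseteq> V" "e \<noteq> {}" "e \<inter> P = {}" using e Suc.prems(5)[of e] by (auto simp: E1_def)
      then have "s \<in> T - {l}" "e \<subseteq> B s" using nbr True by blast+
      then show ?thesis by blast
    next
      case False
      then show ?thesis using Suc.prems(6)[of e] e by blast
    qed
    show "induced_connected F {s \<in> T - {l}. v \<in> B s}" if "v \<in> V - P" for v
    proof -
      have "induced_connected F ({s \<in> T. v \<in> B s} - {l})"
      proof (rule induced_connected_remove_leaf)
        show "induced_connected F {s \<in> T. v \<in> B s}" using Suc.prems(7) that by blast
        show "y = s" if "y \<in> {s \<in> T. v \<in> B s}" "{l, y} \<in> F" for y using leaf that by blast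
      qed (rule Suc.prems(4))
      moreover have "{s \<in> T - {l}. v \<in> B s} = {s \<in> T. v \<in> B s} - {l}" by auto
      ultimately show ?thesis by simp
    qed
    show "finite (B s) \<and> card (B s) \<le> Suc w" if "s \<in> T - {l}" for s using Suc.prems(8) that by blast
  qed (use Suc.prems(1-4) in simp_all)
  \<comment> \<open>An edge meeting \<open>P\<close> can only be covered by the leaf bag, so each
    vertex of \<open>P\<close> has at most \<open>w\<close> possible partners.\<close>
  moreover have "card E1 \<le> w * card P"
  proof -
    have "E1 \<subseteq> (\<Union>v\<in>P. (\<lambda>u. {u, v}) ` (B l - {v}))"
    proof
      fix e assume "e \<in> E1"
      then obtain v where e: "e \<in> E" "v \<in> e" "v \<in> P" by (auto simp: E1_def)
      then obtain u where u: "e = {u, v}" "u \<noteq> v"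
        using Suc.prems(5)[of e] by (auto simp: card_2_iff)
      obtain t where "t \<in> T" "e \<subseteq> B t" using Suc.prems(6) e by blast
      moreover from this have "t = l" using e by (auto simp: P_def)
      ultimately show "e \<in> (\<Union>v\<in>P. (\<lambda>u. {u, v}) ` (B l - {v}))" using e u by auto
    qed
    then have "card E1 \<le> card (\<Union>v\<in>P. (\<lambda>u. {u, v}) ` (B l - {v}))"
      using finP Suc.prems(8)[OF l] by (intro card_mono) auto
    also have "\<dots> \<le> (\<Sum>v\<in>P. card ((\<lambda>u. {u, v}) ` (B l - {v})))"
      by (rule card_UN_le[OF finP])
    also have "\<dots> \<le> (\<Sum>v\<in>P. w)"
    proof (rule sum_mono)
      fix v assume v: "v \<in> P"
      have "card ((\<lambda>u. {u, v}) ` (B l - {v})) \<le> card (B l - {v})"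
        using Suc.prems(8)[OF l] by (intro card_image_le) auto
      also have "\<dots> \<le> w" using v Suc.prems(8)[OF l] by (auto simp: P_def)
      finally show "card ((\<lambda>u. {u, v}) ` (B l - {v})) \<le> w" .
    qed
    finally show ?thesis by (simp add: mult.commute)
  qed
  moreover have "card E = card E1 + card (E - E1)"
    using finE by (simp add: E1_def card_Diff_subset card_mono)
  moreover have "card V = card P + card (V - P)"
    using Suc.prems(2) finP by (simp add: P_def card_Diff_subset card_mono)
  ultimately show ?case by (simp add: algebra_simps)
qed

lemma card_edges_le_tree_width:
  assumes "simple_graph V E"
  shows "card E \<le> tree_width V E * card V"
proof -
  have "\<And>e. e \<in> E \<Longrightarrow> e \<subseteq> V" using assms by (auto simp: simple_graph_def)
  then obtain T :: "nat set" and F B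
    where TD: "tree_decomposition V E T F B" and w: "decomposition_width T B = tree_width V E"
    by (rule tree_width_decomposition)
  have tree: "is_tree T F" using TD by (simp add: tree_decomposition_def)
  have "finite (B s)" if "s \<in> T" for s
    using that TD assms by (auto simp: tree_decomposition_def simple_graph_def intro: finite_subset)
  moreover have "{v} \<notin> F" for v
    using tree by (auto simp: is_tree_def simple_graph_def)
  moreover have "\<nexists>c. is_cycle F c" "finite T" using tree by (auto simp: is_tree_def simple_graph_def)
  moreover have "finite V" "\<And>e. e \<in> E \<Longrightarrow> e \<subseteq> V \<and> card e = 2"
    using assms by (auto simp: simple_graph_def)
  moreover have "\<And>e. e \<in> E \<Longrightarrow> \<exists>s\<in>T. e \<subseteq> B s"
    and "\<And>v. v \<in> V \<Longrightarrow> induced_connected F {s \<in> T. v \<in> B s}"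
    using TD by (auto simp: tree_decomposition_def)
  ultimately show ?thesis
    using card_bag_le[OF TD] w by (intro card_edges_forest_decomposition[of T V F E B]) auto
qed

section \<open>Upper bounds\<close>

text \<open>The weight \<open>k\<close> on each variable makes one additional true variable outweigh
  the penalty \<open>m\<close>, which is at most \<open>k\<close>; at \<open>s = k\<close> any
  positive penalty is decisive.\<close>

lemma qtf_rep_pair_fun:
  assumes "1 \<le> k"
  shows "\<exists>p. qtf_rep (2 * k) (pair_fun k) p \<and>
    real (ml_size p) \<le> 2 * real (2 * k) \<and> ml_tree_width (2 * k) p = 1"
proof -
  let ?p = "quad_poly (2 * k) (- (real k)\<^sup>2) (real k) (- 1) (pairs k)"
  have Q: "I \<subseteq> {1..2 * k} \<and> card I = 2" if "I \<in> pairs k" for I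
    using that pairs_subset pairs_card by blast
  have "pair_fun k x = threshold_sgn (ml_eval ?p x)" for x
  proof -
    define s m where "s = card (true_set (2 * k) x)" and "m = card (pairs k \<inter> Pow (true_set (2 * k) x))"
    have eval: "ml_eval ?p x = - (real k)\<^sup>2 + real k * real s + - 1 * real m"
      unfolding s_def m_def by (rule ml_eval_quad_poly[OF Q])
    have mk: "m \<le> k"
      unfolding m_def using card_mono[of "pairs k"] card_pairs_le[of k] by (meson Int_lower1 finite_pairs order.trans)
    have "m = 0 \<longleftrightarrow> pairs k \<inter> Pow (true_set (2 * k) x) = {}" by (simp add: m_def)
    then have "pair_fun k x \<longleftrightarrow> k < s \<or> (s = k \<and> m = 0)" by (simp add: pair_fun_iff s_def)
    also have "\<dots> \<longleftrightarrow> k * k + m \<le> k * s"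
    proof -
      consider "s < k" | "s = k" | "k < s" by linarith
      then show ?thesis
      proof cases
        case 1
        then have "k * s < k * k" using assms by simp
        then have "\<not> k * k + m \<le> k * s" by linarith
        then show ?thesis using 1 by auto
      next
        case 3
        then have "k * Suc k \<le> k * s" by (intro mult_le_mono) auto
        then have "k * k + m \<le> k * s" using mk unfolding mult_Suc_right by linarith
        then show ?thesis using 3 by auto
      qed auto
    qed
    also have "\<dots> \<longleftrightarrow> real (k * k + m) \<le> real (k * s)" by (simp only: of_nat_le_iff)
    also have "\<dots> \<longleftrightarrow> threshold_sgn (ml_eval ?p x)"
      unfolding threshold_sgn_def eval by (simp add: power2_eq_square algebra_simps)
    finally show ?thesis .
  qed
  then have "qtf_rep (2 * k) (pair_fun k) ?p"
    unfolding qtf_rep_def ptf_rep_def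
    using ml_poly_on_quad_poly[OF Q] ml_degree_quad_poly[OF Q] by auto
  \<comment> \<open>One constant, \<open>2 * k\<close> linear and at most \<open>k\<close> quadratic
    terms: at most \<open>4 * k\<close> since \<open>1 \<le> k\<close>.\<close>
  moreover have "real (ml_size ?p) \<le> 2 * real (2 * k)"
  proof -
    have "ml_size ?p \<le> 1 + 2 * k + card (pairs k)" by (rule ml_size_quad_poly[OF Q])
    then show ?thesis using card_pairs_le[of k] assms by simp
  qed
  moreover have "ml_tree_width (2 * k) ?p = 1"
  proof -
    have "primal_edges (Poly_Mapping.keys ?p) = pairs k" by (rule primal_edges_quad_poly[OF Q]) simp_all
    then show ?thesis using tree_width_pairs[OF assms] by (simp add: ml_tree_width_def)
  qed
  ultimately show ?thesis by blast
qed

text \<open>Adding all two-element terms makes up for the penalty: subtracting 1 on a pair just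
  deletes its term, so no coefficient is negative.\<close>

lemma positive_qtf_rep_pair_fun:
  assumes "1 \<le> k"
  shows "\<exists>p t. positive_qtf_rep (2 * k) (pair_fun k) p t \<and> real (ml_size p) \<le> 3 * real (2 * k) ^ 2"
proof -
  define S2 :: "nat set \<Rightarrow> nat set set" where "S2 X = {I. I \<subseteq> X \<and> card I = 2}" for X
  have cardS2: "card (S2 X) = card X choose 2" if "finite X" for X
    unfolding S2_def by (rule n_subsets[OF that])
  have finS2: "finite (S2 X)" if "finite X" for X
    unfolding S2_def using that by simp
  define Q where "Q = S2 {1..2 * k} - pairs k"
  have Q: "I \<subseteq> {1..2 * k} \<and> card I = 2" if "I \<in> Q" for I
    using that by (auto simp: Q_def S2_def)
  let ?p = "quad_poly (2 * k) 0 1 1 Q" and ?t = "real (k + (k choose 2))"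
  have eval: "pair_fun k x \<longleftrightarrow> ml_eval ?p x \<ge> ?t" for x
  proof -
    let ?X = "true_set (2 * k) x"
    define s m where "s = card ?X" and "m = card (pairs k \<inter> Pow ?X)"
    have sub: "pairs k \<inter> Pow ?X \<subseteq> S2 ?X" by (auto simp: S2_def pairs_card)
    have "Q \<inter> Pow ?X = S2 ?X - pairs k \<inter> Pow ?X"
      using true_set_subset[of "2 * k" x] by (auto simp: Q_def S2_def)
    then have "card (Q \<inter> Pow ?X) = card (S2 ?X) - m"
      using sub by (simp add: m_def card_Diff_subset)
    moreover have "m \<le> card (S2 ?X)"
      unfolding m_def using sub by (intro card_mono finS2) auto
    ultimately have cQ: "real (card (Q \<inter> Pow ?X)) = real (s choose 2) - real m"
      by (simp add: cardS2 s_def)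
    have eval: "ml_eval ?p x = 0 + 1 * real s + 1 * (real (s choose 2) - real m)"
      unfolding s_def cQ[unfolded s_def, symmetric] by (rule ml_eval_quad_poly[OF Q])
    have two: "2 * real (j choose 2) = real j * (real j - 1)" for j
      by (induction j) (auto simp: numeral_2_eq_2 algebra_simps)
    \<comment> \<open>The pairs inside the true set are disjoint, so they occupy
      \<open>2 * m\<close> of its elements.\<close>
    have "2 * m = card (\<Union> (pairs k \<inter> Pow ?X))"
      unfolding m_def
    proof (rule card_partition)
      show "finite (\<Union> (pairs k \<inter> Pow ?X))" by (rule finite_subset[of _ ?X]) auto
      show "c1 \<inter> c2 = {}" if "c1 \<in> pairs k \<inter> Pow ?X" "c2 \<in> pairs k \<inter> Pow ?X" "c1 \<noteq> c2" for c1 c2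
        using that by (intro pairs_disjoint[of c1 k c2]) auto
    qed (auto simp: pairs_card)
    also have "\<dots> \<le> s" unfolding s_def by (intro card_mono) auto
    finally have m2: "2 * m \<le> s" .
    have "m = 0 \<longleftrightarrow> pairs k \<inter> Pow ?X = {}" by (simp add: m_def)
    then have "pair_fun k x \<longleftrightarrow> k < s \<or> (s = k \<and> m = 0)" by (simp add: pair_fun_iff s_def)
    \<comment> \<open>The inequality is doubled to clear the binomials. For \<open>s > k\<close>,
      the part \<open>s * s\<close> already reaches \<open>k * (k + 1)\<close>, and the remaining
      \<open>s\<close> covers \<open>2 * m\<close>.\<close>
    also have "\<dots> \<longleftrightarrow> real k * (real k + 1) + 2 * real m \<le> real s * (real s + 1)"
    proof -
      consider "s < k" | "s = k" | "k < s" by linarith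
      then show ?thesis
      proof cases
        case 1
        then have "real s * (real s + 1) < real k * (real k + 1)"
          by (intro mult_strict_mono) auto
        then show ?thesis using 1 by simp
      next
        case 3
        then have "real k * (real k + 1) \<le> real s * real s" by (intro mult_mono) auto
        then show ?thesis using 3 m2 by (simp add: algebra_simps)
      qed auto
    qed
    also have "\<dots> \<longleftrightarrow> ?t \<le> ml_eval ?p x"
      using two[of s] two[of k] unfolding eval by (intro iffI) (simp_all add: algebra_simps)
    finally show ?thesis .
  qed
  have "{} \<notin> Q" using Q by fastforce
  then have "{} \<notin> Poly_Mapping.keys ?p" by (auto simp: in_keys_iff lookup_quad_poly[OF Q])
  moreover have "Poly_Mapping.lookup ?p I \<ge> 0" for I by (simp add: lookup_quad_poly[OF Q])
  ultimately have "positive_qtf_rep (2 * k) (pair_fun k) ?p ?t"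
    unfolding positive_qtf_rep_def positive_ptf_rep_def ptf_rep_ge_def
    using ml_poly_on_quad_poly[OF Q] ml_degree_quad_poly[OF Q] eval by auto
  moreover have "real (ml_size ?p) \<le> 3 * real (2 * k) ^ 2"
  proof -
    have "card Q \<le> 2 * k choose 2"
      using card_mono[of "S2 {1..2 * k}" Q] finS2 by (auto simp: Q_def cardS2)
    also have "\<dots> = 2 * k * (2 * k - 1) div 2" by (rule choose_two)
    also have "\<dots> \<le> 2 * k * (2 * k - 1)" by (rule div_le_dividend)
    also have "\<dots> \<le> (2 * k)\<^sup>2" unfolding power2_eq_square by (intro mult_le_mono) auto
    finally have "card Q \<le> (2 * k)\<^sup>2" .
    \<comment> \<open>The constant 3 arises from bounding each of the three summands of the size by
      \<open>(2 * k)\<^sup>2\<close>.\<close>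
    moreover have "1 \<le> (2 * k)\<^sup>2" "2 * k \<le> (2 * k)\<^sup>2" using assms by (auto simp: power2_eq_square)
    moreover have "ml_size ?p \<le> 1 + 2 * k + card Q" by (rule ml_size_quad_poly[OF Q])
    ultimately have "ml_size ?p \<le> 3 * (2 * k)\<^sup>2" by linarith
    then have "real (ml_size ?p) \<le> real (3 * (2 * k)\<^sup>2)" by (simp only: of_nat_le_iff)
    then show ?thesis by simp
  qed
  ultimately show ?thesis by blast
qed

section \<open>Lower bounds\<close>

lemma sum_Pow_insert:
  fixes L :: "'a set \<Rightarrow> real"
  assumes "finite S" "u \<notin> S"
  shows "sum L (Pow (insert u S)) = sum L (Pow S) + (\<Sum>I\<in>Pow S. L (insert u I))"
proof -
  have "inj_on (insert u) (Pow S)" using assms by (auto simp: inj_on_def)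
  moreover have "Pow S \<inter> insert u ` Pow S = {}" using assms by auto
  ultimately show ?thesis
    using assms by (simp add: Pow_insert sum.union_disjoint sum.reindex)
qed

text \<open>In degree two, \<open>u\<close> and \<open>v\<close> interact only through
  \<open>L {u, v}\<close>; the other contributions depend on \<open>u\<close> alone or on
  \<open>v\<close> alone and cancel when two ways of pairing up the same four elements are
  compared.\<close>

lemma sum_Pow_insert2:
  fixes L :: "'a set \<Rightarrow> real"
  assumes "finite S" "u \<notin> S" "v \<notin> S" "u \<noteq> v"
    and L: "\<And>I. finite I \<Longrightarrow> card I > 2 \<Longrightarrow> L I = 0"
  shows "sum L (Pow (S \<union> {u, v})) =
    sum L (Pow S) + (\<Sum>I\<in>Pow S. L (insert u I)) + (\<Sum>I\<in>Pow S. L (insert v I)) + L {u, v}"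
proof -
  have "L (insert u (insert v I)) = 0" if "I \<in> Pow S - {{}}" for I
  proof (rule L)
    have "finite I" using that assms(1) finite_subset by auto
    then show "finite (insert u (insert v I))" by simp
    have "card I > 0" using that \<open>finite I\<close> by (simp add: card_gt_0_iff)
    moreover have "u \<notin> I" "v \<notin> I" using that assms by auto
    ultimately show "card (insert u (insert v I)) > 2"
      using \<open>u \<noteq> v\<close> \<open>finite I\<close> by (simp add: card_insert_if)
  qed
  then have "(\<Sum>I\<in>Pow S. L (insert u (insert v I))) = (\<Sum>I\<in>{{}}. L (insert u (insert v I)))"
    using assms(1) by (intro sum.mono_neutral_right) auto
  moreover have "S \<union> {u, v} = insert v (insert u S)" by auto
  ultimately show ?thesis
    using assms(1-4) sum_Pow_insert[of "insert u S" v L] sum_Pow_insert[of S u L]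
      sum_Pow_insert[of S u "\<lambda>I. L (insert v I)"]
    by (simp add: insert_commute)
qed

text \<open>The map \<open>(i + 1) div 2\<close> sends a variable to the index of its pair, so the
  term found has one variable in pair \<open>j\<close> and one in pair \<open>l\<close>.\<close>

lemma positive_qtf_rep_joins_pairs:
  assumes rep: "positive_qtf_rep (2 * k) (pair_fun k) p t"
    and jl: "j \<in> {1..k}" "l \<in> {1..k}" "j \<noteq> l"
  shows "\<exists>e\<in>Poly_Mapping.keys p. card e = 2 \<and> (\<lambda>i. (i + 1) div 2) ` e = {j, l}"
proof -
  define L where "L = Poly_Mapping.lookup p"
  have pos: "L I \<ge> 0" for I using rep by (simp add: positive_qtf_rep_def positive_ptf_rep_def L_def)
  have on: "ml_poly_on (2 * k) p"
    and val: "\<And>x. x \<in> cube (2 * k) \<Longrightarrow> pair_fun k x \<longleftrightarrow> ml_eval p x \<ge> t"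
    using rep by (auto simp: positive_qtf_rep_def positive_ptf_rep_def ptf_rep_ge_def)
  have "ml_degree p \<le> 2" using rep by (simp add: positive_qtf_rep_def)
  then have "card I \<le> 2" if "I \<in> Poly_Mapping.keys p" for I
    using that by (simp add: ml_degree_def)
  then have deg: "L I = 0" if "card I > 2" for I
    using that by (metis L_def in_keys_iff not_le)
  \<comment> \<open>At size \<open>k\<close> the value of the function depends only on whether the
    set contains a pair.\<close>
  define g where "g X = sum L (Pow X)" for X
  have g: "t \<le> g X \<longleftrightarrow> pairs k \<inter> Pow X = {}" if X: "X \<subseteq> {1..2 * k}" "card X = k" for X
  proof -
    obtain x where "x \<in> cube (2 * k)" "true_set (2 * k) x = X" using X(1) by (rule obtain_point)
    then show ?thesis
      using val[of x] X by (simp add: pair_fun_iff ml_eval_eq[OF on] g_def L_def)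
  qed
  \<comment> \<open>The even member of each other pair: \<open>S\<close> contains no pair, and
    adding two new elements reaches the critical size \<open>k\<close>.\<close>
  define S where "S = (\<lambda>i. 2 * i) ` ({1..k} - {j, l})"
  have finS: "finite S" by (simp add: S_def)
  have "card S = card ({1..k} - {j, l})" unfolding S_def by (intro card_image) (auto simp: inj_on_def)
  also have "\<dots> = k - 2" using jl by (simp add: card_Diff_subset)
  finally have cardS: "card S = k - 2" .
  have k2: "2 \<le> k" using jl by auto
  have Ssub: "S \<subseteq> {1..2 * k}" by (auto simp: S_def)
  define a a' b b' where "a = 2 * j - 1" and "a' = 2 * j" and "b = 2 * l - 1" and "b' = 2 * l"
  have notin: "a \<notin> S" "a' \<notin> S" "b \<notin> S" "b' \<notin> S"
    using jl by (auto simp: S_def a_def a'_def b_def b'_def; presburger)+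
  have ne: "a \<noteq> a'" "b \<noteq> b'" "a \<noteq> b" "a' \<noteq> b'"
    using jl by (auto simp: a_def a'_def b_def b'_def)
  have card: "card (S \<union> {u, v}) = k" if "u \<notin> S" "v \<notin> S" "u \<noteq> v" for u v
    using that finS cardS k2 by (simp add: card_insert_if)
  have range: "{a, a', b, b'} \<subseteq> {1..2 * k}"
    using jl by (auto simp: a_def a'_def b_def b'_def)
  have odd_in_S: "2 * i - 1 \<notin> S" if "1 \<le> i" for i
    using that by (auto simp: S_def; presburger)
  have even_in_S: "2 * i \<in> S \<longleftrightarrow> i \<in> {1..k} - {j, l}" for i
    by (auto simp: S_def)
  have expand: "g (S \<union> {u, v}) =
      g S + (\<Sum>I\<in>Pow S. L (insert u I)) + (\<Sum>I\<in>Pow S. L (insert v I)) + L {u, v}"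
    if "u \<notin> S" "v \<notin> S" "u \<noteq> v" for u v
    unfolding g_def by (rule sum_Pow_insert2) (use that finS deg in auto)
  \<comment> \<open>For \<open>i' = 0\<close> the truncated \<open>2 * i' - 1\<close> would be the
    even number 0.\<close>
  have parity: "2 * i \<noteq> 2 * i' - 1" if "1 \<le> i'" for i i' :: nat
    using that by presburger
  have no_pair: "pairs k \<inter> Pow X = {}" if "\<And>i. i \<in> {1..k} \<Longrightarrow> 2 * i - 1 \<notin> X \<or> 2 * i \<notin> X" for X
    using that unfolding pairs_def by blast
  have "t \<le> g (S \<union> {a, b})"
  proof (subst g)
    show "pairs k \<inter> Pow (S \<union> {a, b}) = {}"
    proof (rule no_pair)
      fix i assume i: "i \<in> {1..k}"
      show "2 * i - 1 \<notin> S \<union> {a, b} \<or> 2 * i \<notin> S \<union> {a, b}"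
      proof (cases "i = j \<or> i = l")
        case True
        then show ?thesis using even_in_S[of i] parity[of j i] parity[of l i] jl by (auto simp: a_def b_def)
      next
        case False
        then have "2 * i - 1 \<noteq> a" "2 * i - 1 \<noteq> b" using i jl by (auto simp: a_def b_def)
        then show ?thesis using odd_in_S[of i] i by simp
      qed
    qed
  qed (use Ssub range card notin ne in simp_all)
  moreover have "t \<le> g (S \<union> {a', b'})"
  proof (subst g)
    show "pairs k \<inter> Pow (S \<union> {a', b'}) = {}"
    proof (rule no_pair)
      fix i assume i: "i \<in> {1..k}"
      then show "2 * i - 1 \<notin> S \<union> {a', b'} \<or> 2 * i \<notin> S \<union> {a', b'}"
        using odd_in_S[of i] parity[of i j] parity[of i l] by (auto simp: a'_def b'_def)
    qed
  qed (use Ssub range card notin ne in simp_all)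
  moreover have "g (S \<union> {a, a'}) < t"
  proof -
    have "{a, a'} \<in> pairs k \<inter> Pow (S \<union> {a, a'})" using jl by (auto simp: pairs_def a_def a'_def)
    then have "pairs k \<inter> Pow (S \<union> {a, a'}) \<noteq> {}" by blast
    moreover have "S \<union> {a, a'} \<subseteq> {1..2 * k}" using Ssub range by simp
    moreover have "card (S \<union> {a, a'}) = k" using card notin ne by blast
    ultimately show ?thesis using g[of "S \<union> {a, a'}"] by linarith
  qed
  moreover have "g (S \<union> {b, b'}) < t"
  proof -
    have "{b, b'} \<in> pairs k \<inter> Pow (S \<union> {b, b'})" using jl by (auto simp: pairs_def b_def b'_def)
    then have "pairs k \<inter> Pow (S \<union> {b, b'}) \<noteq> {}" by blast
    moreover have "S \<union> {b, b'} \<subseteq> {1..2 * k}" using Ssub range by simp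
    moreover have "card (S \<union> {b, b'}) = k" using card notin ne by blast
    ultimately show ?thesis using g[of "S \<union> {b, b'}"] by linarith
  qed
  \<comment> \<open>Both sides use each of the four elements once, so after adding the two true and
    the two false values only the coefficients of the added two-element sets survive.\<close>
  ultimately have "L {a, a'} + L {b, b'} < L {a, b} + L {a', b'}"
    using expand[OF notin(1,3) ne(3)] expand[OF notin(2,4) ne(4)]
      expand[OF notin(1,2) ne(1)] expand[OF notin(3,4) ne(2)]
    by linarith
  then have "L {a, b} \<noteq> 0 \<or> L {a', b'} \<noteq> 0"
    using pos[of "{a, a'}"] pos[of "{b, b'}"] by auto
  moreover have "(\<lambda>i. (i + 1) div 2) ` {a, b} = {j, l}" "(\<lambda>i. (i + 1) div 2) ` {a', b'} = {j, l}"
    using jl by (auto simp: a_def b_def a'_def b'_def)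
  ultimately show ?thesis
    using ne by (metis L_def card_2_iff in_keys_iff)
qed

text \<open>Mapping two-element terms to the pair indices they meet covers all two-element subsets
  of \<open>{1..k}\<close>. These terms are also edges of the primal graph, to which the sparsity
  bound on \<open>2 * k\<close> vertices applies.\<close>

lemma positive_qtf_rep_lower_bound:
  assumes rep: "positive_qtf_rep (2 * k) (pair_fun k) p t"
  shows "k choose 2 \<le> ml_size p" "k choose 2 \<le> ml_tree_width (2 * k) p * (2 * k)"
proof -
  define M where "M = {e \<in> Poly_Mapping.keys p. card e = 2}"
  have finM: "finite M" by (simp add: M_def)
  have on: "Poly_Mapping.keys p \<subseteq> Pow {1..2 * k}"
    using rep by (simp add: positive_qtf_rep_def positive_ptf_rep_def ptf_rep_ge_def ml_poly_on_def)
  have "k choose 2 = card {D. D \<subseteq> {1..k} \<and> card D = 2}" by (simp add: n_subsets)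
  also have "\<dots> \<le> card ((\<lambda>e. (\<lambda>i. (i + 1) div 2) ` e) ` M)"
  proof (rule card_mono)
    show "{D. D \<subseteq> {1..k} \<and> card D = 2} \<subseteq> (\<lambda>e. (\<lambda>i. (i + 1) div 2) ` e) ` M"
    proof
      fix D assume "D \<in> {D. D \<subseteq> {1..k} \<and> card D = 2}"
      then obtain j l where "D = {j, l}" "j \<in> {1..k}" "l \<in> {1..k}" "j \<noteq> l" by (auto simp: card_2_iff)
      then show "D \<in> (\<lambda>e. (\<lambda>i. (i + 1) div 2) ` e) ` M"
        using positive_qtf_rep_joins_pairs[OF rep, of j l] unfolding M_def by blast
    qed
  qed (use finM in simp)
  also have "\<dots> \<le> card M" by (rule card_image_le[OF finM])
  finally have M: "k choose 2 \<le> card M" .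
  have "card M \<le> ml_size p" unfolding ml_size_def by (intro card_mono) (auto simp: M_def)
  with M show "k choose 2 \<le> ml_size p" by simp
  let ?E = "primal_edges (Poly_Mapping.keys p)"
  have simple: "simple_graph {1..2 * k} ?E"
    using on by (auto simp: simple_graph_def primal_edges_def)
  have "finite ?E"
    by (rule finite_subset[of _ "Pow {1..2 * k}"]) (use simple in \<open>auto simp: simple_graph_def\<close>)
  moreover have "M \<subseteq> ?E" by (auto simp: M_def primal_edges_def card_2_iff)
  ultimately have "card M \<le> card ?E" by (intro card_mono)
  with M card_edges_le_tree_width[OF simple]
  show "k choose 2 \<le> ml_tree_width (2 * k) p * (2 * k)" by (simp add: ml_tree_width_def)
qed

lemma positive_qtf_rep_lower_bound_real:
  assumes rep: "positive_qtf_rep (2 * k) (pair_fun k) p t" and k: "2 \<le> k"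
  shows "real (ml_size p) \<ge> 1 / 16 * real (2 * k) ^ 2"
    and "real (ml_tree_width (2 * k) p) \<ge> 1 / 16 * real (2 * k)"
proof -
  have "even (k * (k - 1))" by auto
  then have "2 * (k choose 2) = k * (k - 1)" by (simp only: choose_two dvd_mult_div_cancel)
  \<comment> \<open>This is \<open>k \<le> 2 * (k - 1)\<close>, which starts to hold at
    \<open>k = 2\<close>.\<close>
  moreover have "k * k \<le> k * (2 * (k - 1))" using k by (intro mult_le_mono) auto
  moreover have "k * (2 * (k - 1)) = 2 * (k * (k - 1))" by (rule mult.left_commute)
  ultimately have *: "k * k \<le> 4 * (k choose 2)" by linarith
  have "k * k \<le> 4 * ml_size p" using * positive_qtf_rep_lower_bound(1)[OF rep] by linarith
  then have "real (k * k) \<le> real (4 * ml_size p)" by (simp only: of_nat_le_iff)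
  then show "real (ml_size p) \<ge> 1 / 16 * real (2 * k) ^ 2" by (simp add: power2_eq_square)
  have "k * k \<le> k * (8 * ml_tree_width (2 * k) p)"
    using * positive_qtf_rep_lower_bound(2)[OF rep] by (simp only: mult_ac)
  then have "k \<le> 8 * ml_tree_width (2 * k) p" using k by simp
  then have "real k \<le> real (8 * ml_tree_width (2 * k) p)" by (simp only: of_nat_le_iff)
  then show "real (ml_tree_width (2 * k) p) \<ge> 1 / 16 * real (2 * k)" by simp
qed

theorem theorem8:
  "(\<forall>k\<ge>1. monotone_boolean (2 * k) (pair_fun k)) \<and>
   (\<exists>C::real. \<forall>k\<ge>1. \<exists>p. qtf_rep (2 * k) (pair_fun k) p \<and>
      real (ml_size p) \<le> C * real (2 * k) \<and> ml_tree_width (2 * k) p = 1) \<and>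
   (\<exists>C::real. \<forall>k\<ge>1. \<exists>p t. positive_qtf_rep (2 * k) (pair_fun k) p t \<and>
      real (ml_size p) \<le> C * real (2 * k) ^ 2) \<and>
   (\<exists>c::real. c > 0 \<and> (\<forall>\<^sub>F k in sequentially. \<forall>p t.
      positive_qtf_rep (2 * k) (pair_fun k) p t \<longrightarrow>
        real (ml_size p) \<ge> c * real (2 * k) ^ 2 \<and>
        real (ml_tree_width (2 * k) p) \<ge> c * real (2 * k)))"
proof (intro conjI)
  show "\<forall>k\<ge>1. monotone_boolean (2 * k) (pair_fun k)" using monotone_pair_fun by blast
  show "\<exists>C::real. \<forall>k\<ge>1. \<exists>p. qtf_rep (2 * k) (pair_fun k) p \<and>
      real (ml_size p) \<le> C * real (2 * k) \<and> ml_tree_width (2 * k) p = 1"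
    using qtf_rep_pair_fun by blast
  show "\<exists>C::real. \<forall>k\<ge>1. \<exists>p t. positive_qtf_rep (2 * k) (pair_fun k) p t \<and>
      real (ml_size p) \<le> C * real (2 * k) ^ 2"
    using positive_qtf_rep_pair_fun by blast
  show "\<exists>c::real. c > 0 \<and> (\<forall>\<^sub>F k in sequentially. \<forall>p t.
      positive_qtf_rep (2 * k) (pair_fun k) p t \<longrightarrow>
        real (ml_size p) \<ge> c * real (2 * k) ^ 2 \<and>
        real (ml_tree_width (2 * k) p) \<ge> c * real (2 * k))"
  \<comment> \<open>With \<open>n = 2 * k\<close>, the size is at least \<open>k * k / 4\<close>,
    that is \<open>n * n / 16\<close>, and the tree-width at least \<open>k / 8\<close>, that is
    \<open>n / 16\<close>.\<close>
  proof (intro exI[of _ "1 / 16"] conjI)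
    show "\<forall>\<^sub>F k in sequentially. \<forall>p t. positive_qtf_rep (2 * k) (pair_fun k) p t \<longrightarrow>
        real (ml_size p) \<ge> 1 / 16 * real (2 * k) ^ 2 \<and>
        real (ml_tree_width (2 * k) p) \<ge> 1 / 16 * real (2 * k)"
      using eventually_ge_at_top[of 2]
      by eventually_elim (use positive_qtf_rep_lower_bound_real in blast)
  qed simp
qed

end
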